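(* Let $P$ be the uniform probability distribution on the unit circle $C=\{(\cos t,\sin t):0\le t\le2\pi\}\subset\mathbb{R}^2$, and let $L=\{(a\cos\theta,a\sin\theta):0\le\theta\le2\pi\}$ be the circle of radius $a$ concentric with $C$. Let $\alpha_n$ be an optimal set of $n$-points for $P$ with respect to the constraint $S=L$ (that is, the elements of the optimal set lie on $L$), for $n\in\mathbb{N}$ with $n\ge3$. Then $$\alpha_n=\Big\{\Big(a\cos\frac{(2i-1)\pi}{n},\ a\sin\frac{(2i-1)\pi}{n}\Big): i=1,2,\ldots,n\Big\},$$ and the corresponding quantization error is given by $V_n=a^2+1-\dfrac{2an}{\pi}\sin\dfrac{\pi}{n}$.
   Context: Here $r=2$ and distances on $\mathbb{R}^2$ are Euclidean. The uniform distribution $P$ on $C$ has density $\frac{1}{2\pi}$ with respect to arc length on $C$. For a nonempty closed constraint set $S\subseteq\mathbb{R}^2$ and a nonempty finite set $\alpha\subseteq S$, the distortion error is $V(P;\alpha)=\int\min_{p\in\alpha}\|x-p\|^2\,dP(x)$; the $n$th constrained quantization error with respect to $S$ is $V_n=V_n(P)=\inf\{V(P;\alpha):\alpha\subseteq S,\ 1\le\mathrm{card}(\alpha)\le n\}$; an optimal set of $n$-points for $P$ with respect to $S$ is a set $\alpha\subseteq S$ with $1\le\mathrm{card}(\alpha)\le n$ and $V(P;\alpha)=V_n$.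
   Formalization: Any rotation of an optimal set about the origin is again optimal, so the stated equality cannot hold for every optimal set; what is proved is that the displayed set is optimal, that the optimal sets are exactly its rotations, and the formula for V_n (with a > 0). *)

theory Defs
  imports "HOL-Probability.Probability"
begin

definition circle_point :: "real \<Rightarrow> real \<Rightarrow> real ^ 2" where
  "circle_point a \<theta> = vector [a * cos \<theta>, a * sin \<theta>]"

definition origin_circle :: "real \<Rightarrow> (real ^ 2) set" where
  "origin_circle a = {circle_point a \<theta> | \<theta>. 0 \<le> \<theta> \<and> \<theta> \<le> 2 * pi}"

text \<open>
  The parametrisation of the unit circle has unit speed, so arc length on it is the image of
  Lebesgue measure on the parameter interval; the doubly covered point \<open>(1, 0)\<close> is null.
\<close>

definition unit_circle_arclength :: "(real ^ 2) measure" where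
  "unit_circle_arclength = distr (restrict_space lborel {0..2 * pi}) borel (circle_point 1)"

definition uniform_unit_circle :: "(real ^ 2) measure" where
  "uniform_unit_circle = density unit_circle_arclength (\<lambda>_. ennreal (1 / (2 * pi)))"

text \<open>
  The integral below is the Bochner integral, which is 0 for a non-integrable integrand. This is
  harmless for a finite Borel measure concentrated on a bounded set, such as
  \<^const>\<open>uniform_unit_circle\<close>. Likewise \<^const>\<open>Min\<close> is meant for nonempty finite sets \<open>\<alpha>\<close> only.
\<close>

definition distortion :: "(real ^ 2) measure \<Rightarrow> (real ^ 2) set \<Rightarrow> real" where
  "distortion P \<alpha> = (LINT x|P. Min ((\<lambda>p. (norm (x - p))\<^sup>2) ` \<alpha>))"

text \<open>The bound \<open>1 \<le> card \<alpha>\<close> also forces \<open>\<alpha>\<close> to be finite.\<close>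

definition admissible :: "(real ^ 2) set \<Rightarrow> nat \<Rightarrow> (real ^ 2) set \<Rightarrow> bool" where
  "admissible S n \<alpha> \<longleftrightarrow> \<alpha> \<subseteq> S \<and> 1 \<le> card \<alpha> \<and> card \<alpha> \<le> n"

definition quantization_error :: "(real ^ 2) measure \<Rightarrow> (real ^ 2) set \<Rightarrow> nat \<Rightarrow> real" where
  "quantization_error P S n = Inf {distortion P \<alpha> | \<alpha>. admissible S n \<alpha>}"

definition optimal_set ::
    "(real ^ 2) measure \<Rightarrow> (real ^ 2) set \<Rightarrow> nat \<Rightarrow> (real ^ 2) set \<Rightarrow> bool" where
  "optimal_set P S n \<alpha> \<longleftrightarrow> admissible S n \<alpha> \<and> distortion P \<alpha> = quantization_error P S n"

text \<open>
  Rotations about the origin preserve both circles and the uniform distribution, so an optimal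
  set is determined only up to such a rotation; \<open>\<phi>\<close> is the angle of rotation.
\<close>

definition rotated_ngon :: "real \<Rightarrow> nat \<Rightarrow> real \<Rightarrow> (real ^ 2) set" where
  "rotated_ngon a n \<phi> =
     {circle_point a ((2 * real i - 1) * pi / real n + \<phi>) | i. i \<in> {1..n}}"

lemma measurable_circle_point [measurable]: "circle_point a \<in> borel_measurable borel"
proof -
  have "circle_point a = (\<lambda>\<theta>. \<chi> i. if i = 1 then a * cos \<theta> else a * sin \<theta>)"
    by (auto simp: circle_point_def fun_eq_iff vec_eq_iff forall_2)
  moreover have "continuous_on UNIV (\<lambda>\<theta>. \<chi> i::2. if i = 1 then a * cos \<theta> else a * sin \<theta>)"
  proof (intro continuous_on_vec_lambda)
    fix i :: 2
    show "continuous_on UNIV (\<lambda>\<theta>. if i = 1 then a * cos \<theta> else a * sin \<theta>)"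
      by (cases "i = 1") (auto intro!: continuous_intros)
  qed
  ultimately show ?thesis
    by (simp add: borel_measurable_continuous_onI)
qed

lemma prob_space_uniform_unit_circle: "prob_space uniform_unit_circle"
proof
  have m: "circle_point 1 \<in> measurable (restrict_space lborel {0..2 * pi}) borel"
    by (rule measurable_restrict_space1) simp
  have "emeasure unit_circle_arclength UNIV = ennreal (2 * pi)"
    by (simp add: unit_circle_arclength_def emeasure_distr m emeasure_restrict_space
        space_restrict_space)
  moreover have "space unit_circle_arclength = UNIV" "UNIV \<in> sets unit_circle_arclength"
    by (auto simp: unit_circle_arclength_def)
  ultimately show "emeasure uniform_unit_circle (space uniform_unit_circle) = 1"
    by (simp add: uniform_unit_circle_def emeasure_density_const flip: ennreal_mult)
qed

end

theory Submission
  imports Defs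
begin

text \<open>
  The point at angle \<open>\<theta>\<close> on the circle of radius \<open>a\<close> has squared distance \<open>a\<^sup>2 + 1 - 2 * a * cos (t - \<theta>)\<close>
  from the point at angle \<open>t\<close> on the unit circle, so minimising the distortion means maximising
  \<open>\<integral> max\<^sub>\<theta> cos (t - \<theta>) dt\<close>. With \<open>x = \<pi> / n\<close> and \<open>c = cos x\<close>, pointwise
  \<open>max\<^sub>\<theta> cos (t - \<theta>) \<le> c + (\<Sum>\<theta>. max 0 (cos (t - \<theta>) - c))\<close>, and the integral of the right-hand
  side depends only on the number of angles. There is equality for every \<open>t\<close> iff the closed arcs of
  radius \<open>x\<close> around the angles cover the circle and the open ones are disjoint; then with every
  angle \<open>\<theta>\<close> also \<open>\<theta> + 2 * x\<close> is one of the angles, which leaves only the regular \<open>n\<close>-gons.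
\<close>

section \<open>Periodicity\<close>

text \<open>Cut the window at the multiple \<open>w\<close> of \<open>p\<close> inside it: moving
  the left piece one period to the right produces \<open>{w..w + p}\<close>, a translate of
  \<open>{0..p}\<close>.\<close>

lemma integral_period_shift:
  fixes f :: "real \<Rightarrow> real"
  assumes cont: "continuous_on UNIV f" and "p > 0"
    and per: "\<And>t (k::int). f (t + of_int k * p) = f t"
  shows "integral {u..u + p} f = integral {0..p} f"
proof -
  define k where "k = \<lceil>u / p\<rceil>"
  define w where "w = of_int k * p"
  have w: "u \<le> w" "w \<le> u + p"
  proof -
    have "u / p \<le> of_int k" "of_int k < u / p + 1"
      unfolding k_def by linarith+
    with \<open>p > 0\<close> show "u \<le> w" "w \<le> u + p"
      by (auto simp: w_def field_simps)
  qed
  have int: "f integrable_on {r..s}" for r s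
    using cont by (intro integrable_continuous_interval) (blast intro: continuous_on_subset)
  have shift: "integral {r + of_int j * p..s + of_int j * p} f = integral {r..s} f" for r s and j :: int
    using integral_shift_real_ivl[of "r + of_int j * p" "of_int j * p" "s + of_int j * p" f]
    by (simp add: per)
  have "integral {u..u + p} f = integral {u..w} f + integral {w..u + p} f"
    using w int by (simp add: Henstock_Kurzweil_Integration.integral_combine)
  also have "integral {u..w} f = integral {u + p..w + p} f"
    using shift[of u 1 w] by simp
  also have "integral {u + p..w + p} f + integral {w..u + p} f = integral {w..w + p} f"
    using w int Henstock_Kurzweil_Integration.integral_combine[of w "u + p" "w + p" f] by simp
  also have "\<dots> = integral {0..p} f"
    using shift[of 0 k p] by (simp add: w_def add.commute)
  finally show ?thesis .
qed

lemma cos_add_int_period: "cos (t + of_int k * (2 * pi)) = cos (t::real)"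
  using cos_int_2pin[of k] sin_int_2pin[of k] by (simp add: cos_add mult.commute)

text \<open>Brings an angle into the range where \<open>cos\<close> is a decreasing function of the
  absolute value, so that cosine inequalities become distance inequalities.\<close>

lemma exists_angle_representative:
  fixes t :: real
  obtains k :: int where "- pi < t + of_int k * (2 * pi)" "t + of_int k * (2 * pi) \<le> pi"
proof
  define j where "j = \<lfloor>(pi - t) / (2 * pi)\<rfloor>"
  have "of_int j \<le> (pi - t) / (2 * pi)" "(pi - t) / (2 * pi) < of_int j + 1"
    unfolding j_def by linarith+
  then show "- pi < t + of_int j * (2 * pi)" "t + of_int j * (2 * pi) \<le> pi"
    by (auto simp: field_simps)
qed

lemma cos_le_cos_abs_iff:
  assumes "\<bar>t\<bar> \<le> pi" "0 \<le> x" "x \<le> pi"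
  shows "cos x \<le> cos t \<longleftrightarrow> \<bar>t\<bar> \<le> (x::real)"
  using cos_mono_le_eq[of x "\<bar>t\<bar>"] assms by simp

lemma cos_less_cos_abs_iff:
  assumes "\<bar>t\<bar> \<le> pi" "0 \<le> x" "x \<le> pi"
  shows "cos x < cos t \<longleftrightarrow> \<bar>t\<bar> < (x::real)"
  using cos_mono_less_eq[of x "\<bar>t\<bar>"] assms by simp

section \<open>The covering functional\<close>

text \<open>For 0 < x \<le> pi this is positive exactly on the open arc of radius \<open>x\<close>
  around 0, modulo \<open>2 * pi\<close>.\<close>

definition cap :: "real \<Rightarrow> real \<Rightarrow> real" where
  "cap x t = max 0 (cos t - cos x)"

text \<open>Cosine of the angular distance from \<open>t\<close> to the closest angle of
  \<open>T\<close>; meant for finite nonempty \<open>T\<close>.\<close>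

definition nearest_cos :: "real set \<Rightarrow> real \<Rightarrow> real" where
  "nearest_cos T t = Max ((\<lambda>\<theta>. cos (t - \<theta>)) ` T)"

definition slack :: "real \<Rightarrow> real set \<Rightarrow> real \<Rightarrow> real" where
  "slack x T t = cos x + (\<Sum>\<theta>\<in>T. cap x (t - \<theta>)) - nearest_cos T t"

lemma cap_nonneg: "0 \<le> cap x t"
  by (simp add: cap_def)

lemma cap_eq_0_iff: "cap x t = 0 \<longleftrightarrow> cos t \<le> cos x"
  by (auto simp: cap_def max_def)

lemma continuous_on_cap: "continuous_on A (\<lambda>t. cap x (t - \<theta>))"
  unfolding cap_def by (intro continuous_intros)

lemma continuous_on_nearest_cos:
  assumes "finite T" "T \<noteq> {}"
  shows "continuous_on A (nearest_cos T)"
  using assms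
proof (induction rule: finite_ne_induct)
  case (singleton \<theta>)
  show ?case by (auto simp: nearest_cos_def intro!: continuous_intros)
next
  case (insert \<theta> T)
  have "nearest_cos (insert \<theta> T) = (\<lambda>t. max (cos (t - \<theta>)) (nearest_cos T t))"
    using insert.hyps by (simp add: nearest_cos_def fun_eq_iff)
  with insert.IH show ?case by (auto intro!: continuous_intros)
qed

lemma continuous_on_slack:
  assumes "finite T" "T \<noteq> {}"
  shows "continuous_on A (slack x T)"
  unfolding slack_def
  by (intro continuous_intros continuous_on_cap continuous_on_nearest_cos[OF assms, simplified])

text \<open>Periodicity removes the translation by \<theta>. On \<open>{- pi..pi}\<close> the cap is
  \<open>cos t - cos x\<close> for \<bar>t\<bar> \<le> x and 0 elsewhere, with antiderivative
  \<open>sin t - t * cos x\<close>.\<close>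

lemma integral_cap:
  assumes "0 < x" "x \<le> pi"
  shows "integral {0..2 * pi} (\<lambda>t. cap x (t - \<theta>)) = 2 * sin x - 2 * x * cos x"
proof -
  have per: "cap x (t + of_int k * (2 * pi)) = cap x t" for t and k :: int
    by (simp only: cap_def cos_add_int_period)
  have cont: "continuous_on UNIV (cap x)"
    using continuous_on_cap[of UNIV x 0] by simp
  have "integral {0..2 * pi} (\<lambda>t. cap x (t - \<theta>)) = integral {- \<theta>..- \<theta> + 2 * pi} (cap x)"
    using integral_shift_real_ivl[of "- \<theta>" "- \<theta>" "- \<theta> + 2 * pi" "cap x"] by simp
  also have "\<dots> = integral {- pi..- pi + 2 * pi} (cap x)"
    using integral_period_shift[OF cont _ per, of "- \<theta>"]
      integral_period_shift[OF cont _ per, of "- pi"] by simp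
  also have "\<dots> = integral {- pi..pi} (cap x)" by simp
  also have "\<dots> = 2 * sin x - 2 * x * cos x"
  proof (rule integral_unique)
    have "((\<lambda>t. cos t - cos x) has_integral
        ((sin x - x * cos x) - (sin (- x) - (- x) * cos x))) {- x..x}"
      using assms by (intro fundamental_theorem_of_calculus)
        (auto intro!: derivative_eq_intros simp flip: has_real_derivative_iff_has_vector_derivative)
    then have "((\<lambda>t. if t \<in> {- x..x} then cos t - cos x else 0) has_integral
        ((sin x - x * cos x) - (sin (- x) - (- x) * cos x))) {- pi..pi}"
      using assms by (subst has_integral_restrict) auto
    moreover have "(if t \<in> {- x..x} then cos t - cos x else 0) = cap x t" if "t \<in> {- pi..pi}" for t
      using cos_le_cos_abs_iff[of t x] assms that by (auto simp: cap_def abs_le_iff)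
    ultimately show "(cap x has_integral (2 * sin x - 2 * x * cos x)) {- pi..pi}"
      by (subst (asm) has_integral_cong) (auto simp: mult.assoc)
  qed
  finally show ?thesis .
qed

text \<open>The expression vanishes at 0 and has derivative \<open>2 * y * sin y\<close>, which is
  positive on the open interval.\<close>

lemma cap_mass_pos:
  assumes "0 < x" "x \<le> pi"
  shows "0 < 2 * sin x - 2 * x * cos (x::real)"
proof -
  have "(\<lambda>x. 2 * sin x - 2 * x * cos x) 0 < (\<lambda>x. 2 * sin x - 2 * x * cos x) x"
  proof (rule DERIV_pos_imp_increasing_open[OF \<open>0 < x\<close>])
    fix y assume "0 < y" "y < x"
    then have "0 < 2 * y * sin y"
      using sin_gt_zero[of y] assms by simp
    then show "\<exists>d. ((\<lambda>x. 2 * sin x - 2 * x * cos x) has_real_derivative d) (at y) \<and> 0 < d"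
      by (intro exI[of _ "2 * y * sin y"]) (auto intro!: derivative_eq_intros)
  qed (intro continuous_intros)
  then show ?thesis by simp
qed

section \<open>Decomposition and zeros of the slack\<close>

lemma nearest_cos_attained:
  assumes "finite T" "T \<noteq> {}"
  obtains \<theta> where "\<theta> \<in> T" "nearest_cos T t = cos (t - \<theta>)"
proof -
  have "nearest_cos T t \<in> (\<lambda>\<theta>. cos (t - \<theta>)) ` T"
    unfolding nearest_cos_def using assms by (intro Max_in) auto
  then show ?thesis using that by auto
qed

text \<open>The cap of a nearest angle combines with \<open>cos x - nearest_cos T t\<close> into the
  amount by which \<open>t\<close> is left uncovered; the other caps measure overlap. All terms are
  nonnegative.\<close>

lemma slack_split:
  assumes "finite T" "\<theta> \<in> T" "nearest_cos T t = cos (t - \<theta>)"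
  shows "slack x T t = max 0 (cos x - cos (t - \<theta>)) + (\<Sum>\<eta>\<in>T - {\<theta>}. cap x (t - \<eta>))"
  using assms by (simp add: slack_def sum.remove[of T \<theta>] cap_def max_def)

lemma slack_nonneg:
  assumes "finite T" "T \<noteq> {}"
  shows "0 \<le> slack x T t"
proof -
  obtain \<theta> where "\<theta> \<in> T" "nearest_cos T t = cos (t - \<theta>)"
    using nearest_cos_attained[OF assms] .
  then show ?thesis
    using assms by (simp add: slack_split sum_nonneg cap_nonneg)
qed

lemma integral_slack_nonneg:
  assumes "finite T" "T \<noteq> {}"
  shows "0 \<le> integral A (slack x T)"
  \<comment> \<open>If the slack is not integrable on \<open>A\<close>, its integral has the default
    value 0 and the bound still holds.\<close>
  using slack_nonneg[OF assms] by (cases "slack x T integrable_on A")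
    (auto intro: integral_nonneg simp: not_integrable_integral)

text \<open>Both parts of \<open>slack_split\<close> must vanish. Since \<theta> maximises the
  cosine, it reaches the level \<open>cos x\<close>, weakly or strictly, whenever any angle does;
  this allows a criterion that does not mention the maximiser.\<close>

lemma slack_eq_0_iff:
  assumes "finite T" "T \<noteq> {}"
  shows "slack x T t = 0 \<longleftrightarrow>
    (\<exists>\<theta>\<in>T. cos x \<le> cos (t - \<theta>)) \<and>
    (\<forall>\<theta>\<in>T. \<forall>\<eta>\<in>T. cos x < cos (t - \<theta>) \<longrightarrow> cos x < cos (t - \<eta>) \<longrightarrow> \<theta> = \<eta>)"
proof -
  obtain \<theta> where \<theta>: "\<theta> \<in> T" "nearest_cos T t = cos (t - \<theta>)"
    using nearest_cos_attained[OF assms] .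
  have le: "cos (t - \<eta>) \<le> cos (t - \<theta>)" if "\<eta> \<in> T" for \<eta>
    using that assms by (auto simp flip: \<theta>(2) simp: nearest_cos_def)
  have "slack x T t = 0 \<longleftrightarrow>
      max 0 (cos x - cos (t - \<theta>)) = 0 \<and> (\<Sum>\<eta>\<in>T - {\<theta>}. cap x (t - \<eta>)) = 0"
    unfolding slack_split[OF \<open>finite T\<close> \<theta>]
    by (rule add_nonneg_eq_0_iff) (auto intro: sum_nonneg cap_nonneg)
  also have "(\<Sum>\<eta>\<in>T - {\<theta>}. cap x (t - \<eta>)) = 0 \<longleftrightarrow> (\<forall>\<eta>\<in>T - {\<theta>}. cos (t - \<eta>) \<le> cos x)"
    using assms by (subst sum_nonneg_eq_0_iff) (auto simp: cap_eq_0_iff cap_nonneg)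
  finally show ?thesis
    using \<theta> le by (smt (verit) Diff_iff singletonD singletonI)
qed

text \<open>Integrates the definition of \<open>slack\<close>. All caps have the same mass, so the
  positions of the angles enter only through the slack.\<close>

lemma integral_nearest_cos:
  assumes "finite T" "T \<noteq> {}" "0 < x" "x \<le> pi"
  shows "integral {0..2 * pi} (nearest_cos T) =
    2 * pi * cos x + real (card T) * (2 * sin x - 2 * x * cos x) - integral {0..2 * pi} (slack x T)"
proof -
  have "integral {0..2 * pi} (\<lambda>t. cos x + (\<Sum>\<theta>\<in>T. cap x (t - \<theta>)) - slack x T t) =
      2 * pi * cos x + real (card T) * (2 * sin x - 2 * x * cos x) - integral {0..2 * pi} (slack x T)"
    using assms
    by (simp add: Henstock_Kurzweil_Integration.integral_diff Henstock_Kurzweil_Integration.integral_add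
        Henstock_Kurzweil_Integration.integral_sum integrable_continuous_interval
        continuous_intros continuous_on_cap continuous_on_slack integral_cap)
  then show ?thesis by (simp add: slack_def)
qed

section \<open>Optimal configurations of angles\<close>

text \<open>Two angles less than \<open>2 * x\<close> apart would both have the midpoint between
  them in their open arcs. In particular, distinct elements of \<open>T\<close> are distinct modulo
  \<open>2 * pi\<close>.\<close>

lemma separated_if_no_slack:
  assumes T: "finite T" and x: "0 < x" "2 * x \<le> pi" and zero: "\<And>t. slack x T t = 0"
    and mem: "\<theta> \<in> T" "\<eta> \<in> T" "\<theta> \<noteq> \<eta>"
  shows "cos (\<eta> - \<theta>) \<le> cos (2 * x)"
proof (rule ccontr)
  assume *: "\<not> cos (\<eta> - \<theta>) \<le> cos (2 * x)"
  obtain k :: int where k: "- pi < (\<eta> - \<theta>) + of_int k * (2 * pi)" "(\<eta> - \<theta>) + of_int k * (2 * pi) \<le> pi"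
    by (rule exists_angle_representative)
  \<comment> \<open>The signed angle from \<theta> to \<eta>, so \<open>\<theta> + u / 2\<close> is
    the midpoint.\<close>
  define u where "u = (\<eta> - \<theta>) + of_int k * (2 * pi)"
  have "cos u = cos (\<eta> - \<theta>)" unfolding u_def by (rule cos_add_int_period)
  with * have "\<bar>u\<bar> < 2 * x"
    using cos_less_cos_abs_iff[of u "2 * x"] x k by (auto simp: u_def)
  then have "cos x < cos (u / 2)" "cos x < cos (- u / 2)"
    using cos_less_cos_abs_iff[of "u / 2" x] x by auto
  moreover have "cos (\<theta> + u / 2 - \<eta>) = cos (- u / 2)"
  proof -
    have "\<theta> + u / 2 - \<eta> = - u / 2 + of_int k * (2 * pi)" by (simp add: u_def field_simps)
    then show ?thesis by (simp only: cos_add_int_period)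
  qed
  moreover have "\<forall>\<theta>'\<in>T. \<forall>\<eta>'\<in>T. cos x < cos (\<theta> + u / 2 - \<theta>') \<longrightarrow>
      cos x < cos (\<theta> + u / 2 - \<eta>') \<longrightarrow> \<theta>' = \<eta>'"
    using zero[of "\<theta> + u / 2"] mem slack_eq_0_iff[OF T, of x "\<theta> + u / 2"] by blast
  ultimately have "\<theta> = \<eta>" using mem by simp
  with mem show False by simp
qed

text \<open>
  Slightly beyond \<open>\<theta> + x\<close> the angle \<open>\<theta>\<close> no longer covers, so by finiteness some other angle covers
  \<open>\<theta> + x\<close> itself; separation then pins it down.
\<close>

lemma successor_if_no_slack:
  assumes T: "finite T" and x: "0 < x" "2 * x \<le> pi" and zero: "\<And>t. slack x T t = 0"
    and \<theta>: "\<theta> \<in> T"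
  shows "\<exists>\<eta>\<in>T. cos (\<eta> - \<theta> - 2 * x) = 1"
proof -
  have "\<exists>\<eta>\<in>T - {\<theta>}. cos x \<le> cos (\<theta> + x - \<eta>)"
  proof (rule ccontr)
    assume "\<not> ?thesis"
    then have far: "\<forall>\<eta>\<in>T - {\<theta>}. cos (\<theta> + x - \<eta>) < cos x" by (meson not_le)
    have "eventually (\<lambda>e. \<forall>\<eta>\<in>T - {\<theta>}. cos (\<theta> + x + e - \<eta>) < cos x) (at_right 0)"
    proof (intro eventually_ball_finite ballI)
      fix \<eta> assume \<eta>: "\<eta> \<in> T - {\<theta>}"
      have "((\<lambda>e. cos (\<theta> + x + e - \<eta>)) \<longlongrightarrow> cos (\<theta> + x + 0 - \<eta>)) (at_right 0)"
        by (intro tendsto_intros)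
      then show "eventually (\<lambda>e. cos (\<theta> + x + e - \<eta>) < cos x) (at_right 0)"
        using far \<eta> by (auto intro: order_tendstoD(2))
    qed (use T in auto)
    \<comment> \<open>The bound e < x keeps \<open>x + e\<close> below 2 * x \<le> pi, where
      \<open>cos\<close> is still decreasing.\<close>
    moreover have "eventually (\<lambda>e. e \<in> {0<..<x}) (at_right 0)"
      using x by (intro eventually_at_right_real) auto
    ultimately have "eventually (\<lambda>e. (\<forall>\<eta>\<in>T - {\<theta>}. cos (\<theta> + x + e - \<eta>) < cos x) \<and> e \<in> {0<..<x}) (at_right 0)"
      by eventually_elim auto
    then obtain e where e: "\<forall>\<eta>\<in>T - {\<theta>}. cos (\<theta> + x + e - \<eta>) < cos x" "0 < e" "e < x"
      using eventually_happens'[of "at_right (0::real)"] by (auto simp: trivial_limit_at_right_real)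
    have "cos (\<theta> + x + e - \<theta>) < cos x"
      using cos_monotone_0_pi[of x "x + e"] x e by simp
    with e(1) have "\<forall>\<eta>\<in>T. cos (\<theta> + x + e - \<eta>) < cos x" by auto
    moreover have "T \<noteq> {}" using \<theta> by auto
    then have "\<exists>\<eta>\<in>T. cos x \<le> cos (\<theta> + x + e - \<eta>)"
      using zero[of "\<theta> + x + e"] slack_eq_0_iff[OF T, of x "\<theta> + x + e"] by blast
    ultimately show False by force
  qed
  then obtain \<eta> where \<eta>: "\<eta> \<in> T" "\<eta> \<noteq> \<theta>" "cos x \<le> cos (\<theta> + x - \<eta>)" by auto
  obtain k :: int where k: "- pi < (\<eta> - \<theta> - x) + of_int k * (2 * pi)" "(\<eta> - \<theta> - x) + of_int k * (2 * pi) \<le> pi"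
    by (rule exists_angle_representative)
  \<comment> \<open>The signed angle from \<open>\<theta> + x\<close> to \<eta>. Covering gives
    \<bar>u\<bar> \<le> x, so \<open>u + x\<close> lies between 0 and \<open>2 * x\<close>;
    separation from \<theta> forces it to the upper end.\<close>
  define u where "u = (\<eta> - \<theta> - x) + of_int k * (2 * pi)"
  have "cos u = cos (\<eta> - \<theta> - x)" unfolding u_def by (rule cos_add_int_period)
  also have "\<dots> = cos (\<theta> + x - \<eta>)"
    using cos_minus[of "\<eta> - \<theta> - x"] by (simp add: algebra_simps)
  finally have "\<bar>u\<bar> \<le> x"
    using cos_le_cos_abs_iff[of u x] x k \<eta> by (auto simp: u_def)
  have "cos (u + x) = cos (\<eta> - \<theta>)"
    using cos_add_int_period[of "\<eta> - \<theta>" k] by (simp add: u_def algebra_simps)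
  also have "\<dots> \<le> cos (2 * x)"
    using separated_if_no_slack[OF T x zero \<theta> \<eta>(1)] \<eta>(2) by auto
  finally have "2 * x \<le> u + x"
    using cos_mono_le_eq[of "u + x" "2 * x"] x \<open>\<bar>u\<bar> \<le> x\<close> by auto
  with \<open>\<bar>u\<bar> \<le> x\<close> have "u = x" by auto
  then have "\<eta> - \<theta> - 2 * x = 0 + of_int (- k) * (2 * pi)"
    by (simp add: u_def algebra_simps)
  then have "cos (\<eta> - \<theta> - 2 * x) = 1" by (simp only: cos_add_int_period cos_zero)
  then show ?thesis using \<eta> by blast
qed

text \<open>Iterates the successor step. Cosine 1 expresses equality modulo \<open>2 * pi\<close>,
  as \<open>T\<close> consists of real representatives of angles.\<close>

lemma orbit_if_no_slack:
  assumes "finite T" "0 < x" "2 * x \<le> pi" "\<And>t. slack x T t = 0" "\<theta> \<in> T"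
  shows "\<exists>\<eta>\<in>T. cos (\<eta> - (\<theta> + real k * (2 * x))) = 1"
proof (induction k)
  case 0
  show ?case using assms by (intro bexI[of _ \<theta>]) auto
next
  case (Suc k)
  then obtain \<eta> where \<eta>: "\<eta> \<in> T" "cos (\<eta> - (\<theta> + real k * (2 * x))) = 1" by blast
  obtain \<xi> where \<xi>: "\<xi> \<in> T" "cos (\<xi> - \<eta> - 2 * x) = 1"
    using successor_if_no_slack[OF assms(1-4) \<eta>(1)] by blast
  \<comment> \<open>Both summands have cosine 1, hence sine 0, and the addition formula
    applies.\<close>
  have "cos ((\<xi> - \<eta> - 2 * x) + (\<eta> - (\<theta> + real k * (2 * x)))) = 1"
    unfolding cos_add using \<eta> \<xi> by (simp add: cos_one_sin_zero)
  then show ?case using \<xi> by (intro bexI[of _ \<xi>]) (auto simp: algebra_simps)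
qed

section \<open>Angles of regular n-gons\<close>

definition ngon_angles :: "nat \<Rightarrow> real \<Rightarrow> real set" where
  "ngon_angles n \<phi> = (\<lambda>i. (2 * real i - 1) * pi / real n + \<phi>) ` {1..n}"

lemma finite_ngon_angles [simp]: "finite (ngon_angles n \<phi>)"
  by (simp add: ngon_angles_def)

lemma ngon_angles_nonempty: "n \<ge> 1 \<Longrightarrow> ngon_angles n \<phi> \<noteq> {}"
  by (simp add: ngon_angles_def)

lemma card_ngon_angles:
  assumes "n \<ge> 1"
  shows "card (ngon_angles n \<phi>) = n"
proof -
  have "inj_on (\<lambda>i. (2 * real i - 1) * pi / real n + \<phi>) {1..n}"
    using assms by (auto intro!: inj_onI simp: field_simps)
  then show ?thesis by (simp add: ngon_angles_def card_image)
qed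

text \<open>The quantity is an integer multiple \<open>d\<close> of the step
  \<open>2 * pi / real n\<close>, so smallness forces d = 0. Then \<open>i - j\<close> is a multiple
  of \<open>n\<close> of absolute value less than \<open>n\<close>.\<close>

lemma ngon_index_unique:
  fixes m k :: int
  assumes "i \<in> {1..n}" "j \<in> {1..n}" "\<bar>(real i - real j) * (2 * pi / real n) + of_int k * (2 * pi)\<bar> < 2 * pi / real n"
  shows "i = j"
proof -
  have n: "real n > 0" using assms by auto
  define d where "d = int i - int j + k * int n"
  have "(real i - real j) * (2 * pi / real n) + of_int k * (2 * pi) = of_int d * (2 * pi / real n)"
    using n by (simp add: d_def field_simps)
  with assms(3) have "\<bar>of_int d * (2 * pi / real n)\<bar> < 1 * (2 * pi / real n)" by simp
  then have "\<bar>of_int d\<bar> * (2 * pi / real n) < 1 * (2 * pi / real n)" using n by (simp add: abs_mult)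
  then have "\<bar>of_int d :: real\<bar> < 1" using n by (subst (asm) mult_less_cancel_right_pos) auto
  then have "d = 0" by linarith
  then have eq: "int i - int j = - k * int n" by (simp add: d_def)
  moreover have "\<bar>int i - int j\<bar> < int n" using assms by auto
  ultimately have "\<bar>k\<bar> * int n < 1 * int n" by (simp add: abs_mult)
  then have "k = 0" by (subst (asm) mult_less_cancel_right_pos) (use n in auto)
  with eq show ?thesis by simp
qed

text \<open>The arcs of radius \<open>x\<close> around the angles tile the circle: each is a sector
  of width \<open>2 * x\<close>, and \<phi> is a common endpoint of two of them.\<close>

lemma slack_ngon_angles:
  assumes n: "n \<ge> 2"
  shows "slack (pi / real n) (ngon_angles n \<phi>) t = 0"
proof -
  define x where "x = pi / real n"
  have x: "0 < x" "x \<le> pi" "real n * x = pi"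
    using n by (auto simp: x_def field_simps)
  have angle: "(2 * real i - 1) * pi / real n + \<phi> = (2 * real i - 1) * x + \<phi>" for i
    by (simp add: x_def)
  have covered: "\<exists>\<theta>\<in>ngon_angles n \<phi>. cos x \<le> cos (t - \<theta>)"
  proof -
    \<comment> \<open>The number of the sector containing \<open>t\<close>, counted from \<phi> over
      the whole real line.\<close>
    define m where "m = \<lfloor>(t - \<phi>) / (2 * x)\<rfloor>"
    have "of_int m \<le> (t - \<phi>) / (2 * x)" "(t - \<phi>) / (2 * x) < of_int m + 1"
      unfolding m_def by linarith+
    then have m: "of_int m * (2 * x) \<le> t - \<phi>" "t - \<phi> < (of_int m + 1) * (2 * x)"
      using x by (auto simp: field_simps)
    \<comment> \<open>Sectors are counted from 0 but the indices of the angles from 1. Reduction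
      modulo \<open>n\<close> changes the angle by full turns, because n * x = pi.\<close>
    define i where "i = nat (m mod int n) + 1"
    have i: "i \<in> {1..n}" using n by (auto simp: i_def nat_less_iff Suc_le_eq)
    have "int i = m - (m div int n) * int n + 1"
      using n by (simp add: i_def minus_div_mult_eq_mod)
    then have "real_of_int (int i) = of_int (m - (m div int n) * int n + 1)"
      by (rule arg_cong)
    then have ri: "real i = of_int m - of_int (m div int n) * real n + 1"
      by (simp only: of_int_add of_int_diff of_int_mult of_int_1 of_int_of_nat_eq)
    have "t - ((2 * real i - 1) * x + \<phi>) =
        (t - \<phi> - of_int m * (2 * x) - x) + of_int (m div int n) * (2 * (real n * x))"
      unfolding ri by (simp add: algebra_simps)
    then have "cos (t - ((2 * real i - 1) * x + \<phi>)) = cos (t - \<phi> - of_int m * (2 * x) - x)"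
      by (simp only: x(3) cos_add_int_period)
    moreover have "\<bar>t - \<phi> - of_int m * (2 * x) - x\<bar> \<le> x"
      using m by (auto simp: algebra_simps abs_le_iff)
    ultimately have "cos x \<le> cos (t - ((2 * real i - 1) * x + \<phi>))"
      using cos_le_cos_abs_iff[of "t - \<phi> - of_int m * (2 * x) - x" x] x by auto
    then show ?thesis using i by (auto simp: ngon_angles_def angle)
  qed
  have index_eq: "i = j" if ij: "i \<in> {1..n}" "j \<in> {1..n}"
    and close: "cos x < cos (t - ((2 * real i - 1) * x + \<phi>))" "cos x < cos (t - ((2 * real j - 1) * x + \<phi>))" for i j
  proof -
    define u where "u i = t - ((2 * real i - 1) * x + \<phi>)" for i
    have near: "\<exists>k::int. \<bar>u i + of_int k * (2 * pi)\<bar> < x" if "cos x < cos (u i)" for i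
    proof -
      obtain k :: int where k: "- pi < u i + of_int k * (2 * pi)" "u i + of_int k * (2 * pi) \<le> pi"
        by (rule exists_angle_representative)
      then have "\<bar>u i + of_int k * (2 * pi)\<bar> < x"
        using cos_less_cos_abs_iff[of "u i + of_int k * (2 * pi)" x] x that
        by (simp only: cos_add_int_period)
      then show ?thesis ..
    qed
    obtain k l :: int where "\<bar>u i + of_int k * (2 * pi)\<bar> < x" "\<bar>u j + of_int l * (2 * pi)\<bar> < x"
      using near close unfolding u_def by blast
    \<comment> \<open>Two open arcs of radius \<open>x\<close> that contain \<open>t\<close> have
      centres less than one step \<open>2 * x\<close> apart, modulo full turns.\<close>
    then have "\<bar>u j - u i + of_int (l - k) * (2 * pi)\<bar> < 2 * x"
      by (auto simp: abs_less_iff algebra_simps)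
    moreover have "u j - u i = (real i - real j) * (2 * x)" by (simp add: u_def algebra_simps)
    ultimately show ?thesis using ngon_index_unique[OF ij, of "l - k"] by (simp add: x_def)
  qed
  have "\<theta> = \<eta>" if "\<theta> \<in> ngon_angles n \<phi>" "\<eta> \<in> ngon_angles n \<phi>"
    "cos x < cos (t - \<theta>)" "cos x < cos (t - \<eta>)" for \<theta> \<eta>
  proof -
    obtain i j where "i \<in> {1..n}" "j \<in> {1..n}" "\<theta> = (2 * real i - 1) * x + \<phi>" "\<eta> = (2 * real j - 1) * x + \<phi>"
      using \<open>\<theta> \<in> _\<close> \<open>\<eta> \<in> _\<close> unfolding ngon_angles_def angle by blast
    with index_eq[of i j] that show ?thesis by simp
  qed
  moreover have nonempty: "ngon_angles n \<phi> \<noteq> {}" using n by (intro ngon_angles_nonempty) simp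
  ultimately show ?thesis
    unfolding x_def[symmetric] slack_eq_0_iff[OF finite_ngon_angles nonempty]
    using covered by blast
qed

section \<open>Distortion of finite subsets of a concentric circle\<close>

lemma circle_point_nth [simp]:
  "circle_point a \<theta> $ 1 = a * cos \<theta>" "circle_point a \<theta> $ 2 = a * sin \<theta>"
  by (simp_all add: circle_point_def)

lemma circle_point_eqI:
  assumes "cos (\<theta> - \<eta>) = 1"
  shows "circle_point a \<theta> = circle_point a \<eta>"
proof -
  obtain k :: int where "\<theta> - \<eta> = of_int k * 2 * pi" using assms cos_one_2pi_int by blast
  then have "\<theta> = \<eta> + 2 * pi * of_int k" by (simp add: algebra_simps)
  then have "sin \<theta> = sin \<eta> \<and> cos \<theta> = cos \<eta>" using sin_cos_eq_iff by blast
  then show ?thesis by (simp add: vec_eq_iff forall_2)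
qed

lemma circle_point_in_origin_circle: "circle_point a \<theta> \<in> origin_circle a"
proof -
  \<comment> \<open>Normalising \<open>\<theta> - pi\<close> instead of \<theta> lands in the
    parameter range from 0 to \<open>2 * pi\<close>.\<close>
  obtain k :: int where k: "- pi < (\<theta> - pi) + of_int k * (2 * pi)" "(\<theta> - pi) + of_int k * (2 * pi) \<le> pi"
    by (rule exists_angle_representative)
  have "circle_point a (\<theta> + of_int k * (2 * pi)) = circle_point a \<theta>"
    by (rule circle_point_eqI) (use cos_add_int_period[of 0 k] in simp)
  then show ?thesis
    unfolding origin_circle_def using k by (auto intro!: exI[of _ "\<theta> + of_int k * (2 * pi)"])
qed

lemma circle_point_eq_iff:
  assumes "a > 0"
  shows "circle_point a \<theta> = circle_point a \<eta> \<longleftrightarrow> cos (\<theta> - \<eta>) = 1"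
proof
  assume "circle_point a \<theta> = circle_point a \<eta>"
  then have "circle_point a \<theta> $ 1 = circle_point a \<eta> $ 1" "circle_point a \<theta> $ 2 = circle_point a \<eta> $ 2"
    by simp_all
  then have "cos \<theta> = cos \<eta>" "sin \<theta> = sin \<eta>" using assms by simp_all
  then show "cos (\<theta> - \<eta>) = 1"
    using sin_cos_squared_add3[of \<eta>] by (simp add: cos_diff)
qed (rule circle_point_eqI)

lemma rotated_ngon_eq: "rotated_ngon a n \<phi> = circle_point a ` ngon_angles n \<phi>"
  by (auto simp: rotated_ngon_def ngon_angles_def)

lemma card_rotated_ngon:
  assumes "a > 0" "n \<ge> 1"
  shows "card (rotated_ngon a n \<phi>) = n"
proof -
  have "inj_on (circle_point a) (ngon_angles n \<phi>)"
  proof (rule inj_onI)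
    fix \<theta> \<eta> assume *: "\<theta> \<in> ngon_angles n \<phi>" "\<eta> \<in> ngon_angles n \<phi>" "circle_point a \<theta> = circle_point a \<eta>"
    then obtain i j where ij: "i \<in> {1..n}" "\<theta> = (2 * real i - 1) * pi / real n + \<phi>"
      "j \<in> {1..n}" "\<eta> = (2 * real j - 1) * pi / real n + \<phi>"
      by (auto simp: ngon_angles_def)
    obtain k :: int where "\<theta> - \<eta> = of_int k * 2 * pi"
      using * assms circle_point_eq_iff cos_one_2pi_int by metis
    moreover have "\<theta> - \<eta> = (real i - real j) * (2 * pi / real n)"
      using ij assms by (simp add: field_simps)
    \<comment> \<open>The two multiples cancel, so the absolute value is in fact 0.\<close>
    ultimately have "\<bar>(real i - real j) * (2 * pi / real n) + of_int (- k) * (2 * pi)\<bar> < 2 * pi / real n"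
      using assms by simp
    then have "i = j" by (rule ngon_index_unique[OF ij(1,3)])
    with ij show "\<theta> = \<eta>" by simp
  qed
  then show ?thesis using assms by (simp add: rotated_ngon_eq card_image card_ngon_angles)
qed

text \<open>The law of cosines for the triangle formed by the two points and the origin.\<close>

lemma norm_circle_point_diff_sq:
  "(norm (circle_point 1 t - circle_point a \<theta>))\<^sup>2 = a\<^sup>2 + 1 - 2 * a * cos (t - \<theta>)"
proof -
  have "(norm (circle_point 1 t - circle_point a \<theta>))\<^sup>2 = (cos t - a * cos \<theta>)\<^sup>2 + (sin t - a * sin \<theta>)\<^sup>2"
    unfolding power2_norm_eq_inner inner_vec_def sum_2 by (simp add: power2_eq_square)
  also have "\<dots> = ((sin t)\<^sup>2 + (cos t)\<^sup>2) + a\<^sup>2 * ((sin \<theta>)\<^sup>2 + (cos \<theta>)\<^sup>2) - 2 * a * (cos t * cos \<theta> + sin t * sin \<theta>)"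
    by algebra
  finally show ?thesis by (simp add: cos_diff)
qed

text \<open>For a > 0 the squared distance decreases as the cosine grows, so the minimum occurs at a
  largest cosine.\<close>

lemma Min_dist_sq_eq:
  assumes "a > 0" "finite T" "T \<noteq> {}"
  shows "Min ((\<lambda>p. (norm (circle_point 1 t - p))\<^sup>2) ` circle_point a ` T) =
    a\<^sup>2 + 1 - 2 * a * nearest_cos T t"
proof -
  obtain \<theta> where \<theta>: "\<theta> \<in> T" "nearest_cos T t = cos (t - \<theta>)"
    using nearest_cos_attained[OF assms(2,3)] .
  have "cos (t - \<eta>) \<le> nearest_cos T t" if "\<eta> \<in> T" for \<eta>
    using that assms by (auto simp: nearest_cos_def)
  with \<theta> assms show ?thesis
    unfolding image_image norm_circle_point_diff_sq
    by (intro Min_eqI) (auto intro!: rev_image_eqI[of \<theta>])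
qed

lemma distortion_circle_points:
  assumes "a > 0" "finite T" "T \<noteq> {}"
  shows "distortion uniform_unit_circle (circle_point a ` T) =
    a\<^sup>2 + 1 - a / pi * integral {0..2 * pi} (nearest_cos T)"
proof -
  define f where "f x = Min ((\<lambda>p. (norm (x - p))\<^sup>2) ` circle_point a ` T)" for x :: "real ^ 2"
  have [measurable]: "f \<in> borel_measurable borel"
    unfolding f_def using assms(2)
    by (intro borel_measurable_Min) (auto intro!: borel_measurable_continuous_onI continuous_intros)
  have [measurable]: "circle_point 1 \<in> measurable (restrict_space lborel {0..2 * pi}) borel"
    by (rule measurable_restrict_space1) simp
  have f: "f (circle_point 1 t) = a\<^sup>2 + 1 - 2 * a * nearest_cos T t" for t
    unfolding f_def by (rule Min_dist_sq_eq[OF assms])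
  have cont: "continuous_on A (nearest_cos T)" for A
    by (rule continuous_on_nearest_cos[OF assms(2,3)])
  have "distortion uniform_unit_circle (circle_point a ` T) = (LINT x|unit_circle_arclength. 1 / (2 * pi) * f x)"
    unfolding distortion_def uniform_unit_circle_def f_def[symmetric]
    by (subst integral_density) (auto simp: unit_circle_arclength_def)
  also have "\<dots> = (LINT t|restrict_space lborel {0..2 * pi}. 1 / (2 * pi) * f (circle_point 1 t))"
    unfolding unit_circle_arclength_def by (subst integral_distr) auto
  also have "\<dots> = (LINT t:{0..2 * pi}|lborel. 1 / (2 * pi) * (a\<^sup>2 + 1 - 2 * a * nearest_cos T t))"
    by (subst integral_restrict_space) (auto simp: f set_lebesgue_integral_def)
  \<comment> \<open>Continuity on a compact interval identifies the Lebesgue integral with the gauge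
    integral.\<close>
  also have "\<dots> = integral {0..2 * pi} (\<lambda>t. 1 / (2 * pi) * (a\<^sup>2 + 1 - 2 * a * nearest_cos T t))"
    by (intro set_borel_integral_eq_integral borel_integrable_atLeastAtMost' continuous_intros cont)
  also have "\<dots> = 1 / (2 * pi) * (2 * pi * (a\<^sup>2 + 1) - 2 * a * integral {0..2 * pi} (nearest_cos T))"
    by (simp add: Henstock_Kurzweil_Integration.integral_diff integrable_continuous_interval
        continuous_intros cont)
  finally show ?thesis by (simp add: field_simps)
qed

section \<open>Minimality and uniqueness of the regular n-gons\<close>

definition ngon_error :: "real \<Rightarrow> nat \<Rightarrow> real" where
  "ngon_error a n = a\<^sup>2 + 1 - 2 * a * real n / pi * sin (pi / real n)"

text \<open>The excess over \<open>ngon_error\<close> splits into a cost for missing angles and the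
  integrated slack, both nonnegative when card T \<le> n.\<close>

lemma distortion_eq_ngon_error_plus:
  assumes "a > 0" "finite T" "T \<noteq> {}" "n \<ge> 1"
  defines "x \<equiv> pi / real n"
  shows "distortion uniform_unit_circle (circle_point a ` T) = ngon_error a n +
    a / pi * ((real n - real (card T)) * (2 * sin x - 2 * x * cos x) + integral {0..2 * pi} (slack x T))"
proof -
  have x: "0 < x" "x \<le> pi" "pi = real n * x" using assms by (auto simp: x_def field_simps)
  \<comment> \<open>The choice n * x = pi makes the \<open>cos x\<close> terms cancel.\<close>
  have "2 * pi * cos x + real n * (2 * sin x - 2 * x * cos x) = 2 * real n * sin x"
    by (subst x(3)) (simp add: algebra_simps)
  moreover define E where "E = (real n - real (card T)) * (2 * sin x - 2 * x * cos x) + integral {0..2 * pi} (slack x T)"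
  ultimately have int: "integral {0..2 * pi} (nearest_cos T) = 2 * real n * sin x - E"
    using integral_nearest_cos[OF assms(2,3) x(1,2)] by (simp add: left_diff_distrib)
  show ?thesis
    unfolding distortion_circle_points[OF assms(1-3)] ngon_error_def x_def[symmetric] int
      E_def[symmetric] by (simp add: algebra_simps)
qed

text \<open>One angle is chosen for each point, so the cardinality is preserved.\<close>

lemma admissible_circle_points:
  assumes "admissible (origin_circle a) n \<alpha>"
  obtains T where "finite T" "T \<noteq> {}" "card T = card \<alpha>" "\<alpha> = circle_point a ` T"
proof -
  have \<alpha>: "\<alpha> \<subseteq> origin_circle a" "1 \<le> card \<alpha>" using assms by (auto simp: admissible_def)
  then have "\<alpha> \<subseteq> circle_point a ` UNIV" by (auto simp: origin_circle_def)
  then obtain T where T: "inj_on (circle_point a) T" "\<alpha> = circle_point a ` T"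
    by (auto simp: subset_image_inj)
  \<comment> \<open>An infinite set has \<open>card\<close> 0, which the lower bound
    excludes.\<close>
  moreover have "finite \<alpha>" "\<alpha> \<noteq> {}" using \<alpha> card.infinite by force+
  ultimately show ?thesis using that[of T] by (auto simp: card_image finite_image_iff)
qed

lemma ngon_error_le_distortion:
  assumes "a > 0" "n \<ge> 1" "admissible (origin_circle a) n \<alpha>"
  shows "ngon_error a n \<le> distortion uniform_unit_circle \<alpha>"
proof -
  define x where "x = pi / real n"
  have x: "0 < x" "x \<le> pi" using assms by (auto simp: x_def field_simps)
  obtain T where T: "finite T" "T \<noteq> {}" "card T = card \<alpha>" "\<alpha> = circle_point a ` T"
    using admissible_circle_points[OF assms(3)] .
  have "0 \<le> integral {0..2 * pi} (slack x T)"
    by (rule integral_slack_nonneg[OF T(1,2)])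
  moreover have "0 \<le> (real n - real (card T)) * (2 * sin x - 2 * x * cos x)"
    using assms(3) T cap_mass_pos[OF x] by (auto simp: admissible_def)
  ultimately show ?thesis
    using distortion_eq_ngon_error_plus[OF assms(1) T(1,2) assms(2)] assms(1)
    by (simp add: T(4) x_def)
qed

lemma admissible_rotated_ngon:
  assumes "a > 0" "n \<ge> 1"
  shows "admissible (origin_circle a) n (rotated_ngon a n \<phi>)"
  using assms card_rotated_ngon[of a n \<phi>] circle_point_in_origin_circle
  by (auto simp: admissible_def rotated_ngon_eq)

lemma distortion_rotated_ngon:
  assumes "a > 0" "n \<ge> 2"
  shows "distortion uniform_unit_circle (rotated_ngon a n \<phi>) = ngon_error a n"
proof -
  have "slack (pi / real n) (ngon_angles n \<phi>) = (\<lambda>t. 0)"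
    using slack_ngon_angles[OF assms(2)] by auto
  then show ?thesis
    using distortion_eq_ngon_error_plus[of a "ngon_angles n \<phi>" n] assms
    by (simp add: rotated_ngon_eq card_ngon_angles ngon_angles_nonempty)
qed

text \<open>Minimality makes the integrated slack vanish, and continuity then the slack itself. The
  orbit of one angle under steps of \<open>2 * x\<close> gives a full n-gon inside \<alpha>, and
  \<alpha> has no room for further points.\<close>

lemma rotated_ngon_if_minimal:
  assumes "a > 0" "n \<ge> 2" "admissible (origin_circle a) n \<alpha>"
    and min: "distortion uniform_unit_circle \<alpha> = ngon_error a n"
  shows "\<exists>\<phi>. \<alpha> = rotated_ngon a n \<phi>"
proof -
  define x where "x = pi / real n"
  have x: "0 < x" "x \<le> pi" "2 * x \<le> pi" using assms by (auto simp: x_def field_simps)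
  obtain T where T: "finite T" "T \<noteq> {}" "card T = card \<alpha>" "\<alpha> = circle_point a ` T"
    using admissible_circle_points[OF assms(3)] .
  have slack_int: "0 \<le> integral {0..2 * pi} (slack x T)"
    by (rule integral_slack_nonneg[OF T(1,2)])
  have "0 \<le> (real n - real (card T)) * (2 * sin x - 2 * x * cos x)"
    using assms(3) T cap_mass_pos[OF x(1,2)] by (auto simp: admissible_def)
  with slack_int have "integral {0..2 * pi} (slack x T) = 0"
    using distortion_eq_ngon_error_plus[OF assms(1) T(1,2), of n] assms(1,2) min
    by (simp add: T(4) x_def)
  \<comment> \<open>A continuous nonnegative function with integral 0 over an interval vanishes
    there.\<close>
  then have zero_on: "slack x T t = 0" if "t \<in> {0..2 * pi}" for t
    using that T by (subst (asm) integral_eq_0_iff) (auto intro: continuous_on_slack slack_nonneg)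
  \<comment> \<open>The orbit argument evaluates the slack at arbitrary reals, so periodicity
    extends the vanishing.\<close>
  have zero: "slack x T t = 0" for t
  proof -
    obtain k :: int where k: "- pi < (t - pi) + of_int k * (2 * pi)" "(t - pi) + of_int k * (2 * pi) \<le> pi"
      by (rule exists_angle_representative)
    have "cos (t + of_int k * (2 * pi) - \<theta>) = cos (t - \<theta>)" for \<theta>
      using cos_add_int_period[of "t - \<theta>" k] by (simp add: algebra_simps)
    then have "slack x T t = slack x T (t + of_int k * (2 * pi))"
      by (simp add: slack_def cap_def nearest_cos_def)
    also have "\<dots> = 0" by (rule zero_on) (use k in auto)
    finally show ?thesis .
  qed
  obtain \<theta> where \<theta>: "\<theta> \<in> T" using T by auto
  have "rotated_ngon a n (\<theta> - x) \<subseteq> \<alpha>"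
  proof
    fix p assume "p \<in> rotated_ngon a n (\<theta> - x)"
    then obtain i where i: "i \<in> {1..n}" and p: "p = circle_point a ((2 * real i - 1) * pi / real n + (\<theta> - x))"
      by (auto simp: rotated_ngon_def)
    \<comment> \<open>The rotation by \<open>\<theta> - x\<close> puts the vertex with index 1 at
      \<theta> itself.\<close>
    have angle: "(2 * real i - 1) * pi / real n + (\<theta> - x) = \<theta> + real (i - 1) * (2 * x)"
      using i by (simp add: x_def of_nat_diff field_simps)
    obtain \<eta> where \<eta>: "\<eta> \<in> T" "cos (\<eta> - (\<theta> + real (i - 1) * (2 * x))) = 1"
      using orbit_if_no_slack[OF T(1) x(1,3) zero \<theta>] by blast
    then have "p = circle_point a \<eta>"
      unfolding p angle by (intro circle_point_eqI[symmetric])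
    with \<eta> show "p \<in> \<alpha>" by (simp add: T(4))
  qed
  moreover have "card \<alpha> \<le> card (rotated_ngon a n (\<theta> - x))" 
    using assms card_rotated_ngon[of a n] by (simp add: admissible_def)
  ultimately have "rotated_ngon a n (\<theta> - x) = \<alpha>"
    using T by (intro card_seteq) auto
  then show ?thesis by blast
qed

theorem theorem4p3:
  fixes a :: real and n :: nat
  assumes "a > 0" and "n \<ge> 3"
  shows "optimal_set uniform_unit_circle (origin_circle a) n
           {circle_point a ((2 * real i - 1) * pi / real n) | i. i \<in> {1..n}} \<and>
         (\<forall>\<alpha>. optimal_set uniform_unit_circle (origin_circle a) n \<alpha> \<longleftrightarrow>
            (\<exists>\<phi>. \<alpha> = rotated_ngon a n \<phi>)) \<and>
         quantization_error uniform_unit_circle (origin_circle a) n =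
           a\<^sup>2 + 1 - 2 * a * real n / pi * sin (pi / real n)"
proof -
  have n: "n \<ge> 1" "n \<ge> 2" using assms by auto
  note adm = admissible_rotated_ngon[OF assms(1) n(1)]
  note dist = distortion_rotated_ngon[OF assms(1) n(2)]
  \<comment> \<open>The infimum is a minimum: \<open>ngon_error\<close> is a lower bound, and the
    regular n-gon attains it.\<close>
  have err: "quantization_error uniform_unit_circle (origin_circle a) n = ngon_error a n"
    unfolding quantization_error_def
  proof (rule cInf_eq_minimum)
    show "ngon_error a n \<in> {distortion uniform_unit_circle \<alpha> |\<alpha>. admissible (origin_circle a) n \<alpha>}"
      using adm[of 0] dist[of 0] by force
  qed (use ngon_error_le_distortion[OF assms(1) n(1)] in auto)
  have opt: "optimal_set uniform_unit_circle (origin_circle a) n \<alpha> \<longleftrightarrow> (\<exists>\<phi>. \<alpha> = rotated_ngon a n \<phi>)" for \<alpha>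
    using adm dist rotated_ngon_if_minimal[OF assms(1) n(2)] by (auto simp: optimal_set_def err)
  have "{circle_point a ((2 * real i - 1) * pi / real n) | i. i \<in> {1..n}} = rotated_ngon a n 0"
    by (simp add: rotated_ngon_def)
  then show ?thesis using opt err by (auto simp: ngon_error_def)
qed

end
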